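(* Let $t\ge 3$, let $j',j'',j$ be positive integers with $j<\min\{j',j''\}$ and $j'+j''-j<t$, and let $\ell',\ell'',\ell^{\cap},\ell\in\{1,\ldots,t\}$ be odd. Let $\mathcal{F}$ be the family of all ordered pairs $(A,B)$ of subsets of $E_t=\{1,\ldots,t\}$ such that $$|A|=j'<t,\quad |B|=j''<t,\quad 0<|A\cap B|=j,\quad \max\{j',j''\}<|A\cup B|<t,$$ $$\mathfrak{q}(A-B)=\ell',\quad \mathfrak{q}(B-A)=\ell'',\quad \mathfrak{q}(A\cap B)=\ell^{\cap},\quad \mathfrak{q}(A\cup B)=\ell.$$ Put $n:=t-(j'+j''-j)$. Then: (i) The number of pairs $(A,B)\in\mathcal{F}$ with $\{1,t\}\cap A=\{1,t\}\cap B=\{1\}$ is $$\mathfrak{F}\left(\gamma,\theta;\tfrac{\ell+1}{2},\tfrac{\ell'-1}{2},\tfrac{\ell''-1}{2},\tfrac{\ell^{\cap}+1}{2}\right)\cdot\mathtt{c}\bigl(\tfrac{\ell+1}{2};n\bigr)\cdot\mathtt{c}\bigl(\tfrac{\ell'-1}{2};j'-j\bigr)\cdot\mathtt{c}\bigl(\tfrac{\ell''-1}{2};j''-j\bigr)\cdot\mathtt{c}\bigl(\tfrac{\ell^{\cap}+1}{2};j\bigr).$$ (ii) The number of pairs $(A,B)\in\mathcal{F}$ with $\{1,t\}\cap A=\{1\}$ and $\{1,t\}\cap B=\{1,t\}$ is $$\mathfrak{F}\left(\gamma,\beta;\tfrac{\ell-1}{2},\tfrac{\ell'-1}{2},\tfrac{\ell''+1}{2},\tfrac{\ell^{\cap}+1}{2}\right)\cdot\mathtt{c}\bigl(\tfrac{\ell-1}{2};n\bigr)\cdot\mathtt{c}\bigl(\tfrac{\ell'-1}{2};j'-j\bigr)\cdot\mathtt{c}\bigl(\tfrac{\ell''+1}{2};j''-j\bigr)\cdot\mathtt{c}\bigl(\tfrac{\ell^{\cap}+1}{2};j\bigr).$$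 (iii) The number of pairs $(A,B)\in\mathcal{F}$ with $\{1,t\}\cap A=\{1\}$ and $|\{1,t\}\cap B|=0$ is $$\mathfrak{F}\left(\alpha,\theta;\tfrac{\ell+1}{2},\tfrac{\ell'+1}{2},\tfrac{\ell''-1}{2},\tfrac{\ell^{\cap}-1}{2}\right)\cdot\mathtt{c}\bigl(\tfrac{\ell+1}{2};n\bigr)\cdot\mathtt{c}\bigl(\tfrac{\ell'+1}{2};j'-j\bigr)\cdot\mathtt{c}\bigl(\tfrac{\ell''-1}{2};j''-j\bigr)\cdot\mathtt{c}\bigl(\tfrac{\ell^{\cap}-1}{2};j\bigr).$$ (iv) The number of pairs $(A,B)\in\mathcal{F}$ with $\{1,t\}\cap A=\{1\}$ and $\{1,t\}\cap B=\{t\}$ is $$\mathfrak{F}\left(\alpha,\beta;\tfrac{\ell-1}{2},\tfrac{\ell'+1}{2},\tfrac{\ell''+1}{2},\tfrac{\ell^{\cap}-1}{2}\right)\cdot\mathtt{c}\bigl(\tfrac{\ell-1}{2};n\bigr)\cdot\mathtt{c}\bigl(\tfrac{\ell'+1}{2};j'-j\bigr)\cdot\mathtt{c}\bigl(\tfrac{\ell''+1}{2};j''-j\bigr)\cdot\mathtt{c}\bigl(\tfrac{\ell^{\cap}-1}{2};j\bigr).$$ (v) The number of pairs $(A,B)\in\mathcal{F}$ with $\{1,t\}\cap A=\{1,t\}\cap B=\{1,t\}$ is $$\mathfrak{F}\left(\gamma,\gamma;\tfrac{\ell-1}{2},\tfrac{\ell'-1}{2},\tfrac{\ell''-1}{2},\tfrac{\ell^{\cap}+1}{2}\right)\cdot\mathtt{c}\bigl(\tfrac{\ell-1}{2};n\bigr)\cdot\mathtt{c}\bigl(\tfrac{\ell'-1}{2};j'-j\bigr)\cdot\mathtt{c}\bigl(\tfrac{\ell''-1}{2};j''-j\bigr)\cdot\mathtt{c}\bigl(\tfrac{\ell^{\cap}+1}{2};j\bigr).$$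 (vi) The number of pairs $(A,B)\in\mathcal{F}$ with $\{1,t\}\cap A=\{1,t\}$ and $|\{1,t\}\cap B|=0$ is $$\mathfrak{F}\left(\alpha,\alpha;\tfrac{\ell-1}{2},\tfrac{\ell'+1}{2},\tfrac{\ell''-1}{2},\tfrac{\ell^{\cap}-1}{2}\right)\cdot\mathtt{c}\bigl(\tfrac{\ell-1}{2};n\bigr)\cdot\mathtt{c}\bigl(\tfrac{\ell'+1}{2};j'-j\bigr)\cdot\mathtt{c}\bigl(\tfrac{\ell''-1}{2};j''-j\bigr)\cdot\mathtt{c}\bigl(\tfrac{\ell^{\cap}-1}{2};j\bigr).$$ (vii) The number of pairs $(A,B)\in\mathcal{F}$ with $\{1,t\}\cap A=\{1,t\}$ and $\{1,t\}\cap B=\{t\}$ is $$\mathfrak{F}\left(\alpha,\gamma;\tfrac{\ell-1}{2},\tfrac{\ell'+1}{2},\tfrac{\ell''-1}{2},\tfrac{\ell^{\cap}+1}{2}\right)\cdot\mathtt{c}\bigl(\tfrac{\ell-1}{2};n\bigr)\cdot\mathtt{c}\bigl(\tfrac{\ell'+1}{2};j'-j\bigr)\cdot\mathtt{c}\bigl(\tfrac{\ell''-1}{2};j''-j\bigr)\cdot\mathtt{c}\bigl(\tfrac{\ell^{\cap}+1}{2};j\bigr).$$ (viii) The number of pairs $(A,B)\in\mathcal{F}$ with $|\{1,t\}\cap A|=|\{1,t\}\cap B|=0$ is $$\mathfrak{F}\left(\theta,\theta;\tfrac{\ell+1}{2},\tfrac{\ell'-1}{2},\tfrac{\ell''-1}{2},\tfrac{\ell^{\cap}-1}{2}\right)\cdot\mathtt{c}\bigl(\tfrac{\ell+1}{2};n\bigr)\cdot\mathtt{c}\bigl(\tfrac{\ell'-1}{2};j'-j\bigr)\cdot\mathtt{c}\bigl(\tfrac{\ell''-1}{2};j''-j\bigr)\cdot\mathtt{c}\bigl(\tfrac{\ell^{\cap}-1}{2};j\bigr).$$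 (ix) The number of pairs $(A,B)\in\mathcal{F}$ with $|\{1,t\}\cap A|=0$ and $\{1,t\}\cap B=\{t\}$ is $$\mathfrak{F}\left(\theta,\beta;\tfrac{\ell+1}{2},\tfrac{\ell'-1}{2},\tfrac{\ell''+1}{2},\tfrac{\ell^{\cap}-1}{2}\right)\cdot\mathtt{c}\bigl(\tfrac{\ell+1}{2};n\bigr)\cdot\mathtt{c}\bigl(\tfrac{\ell'-1}{2};j'-j\bigr)\cdot\mathtt{c}\bigl(\tfrac{\ell''+1}{2};j''-j\bigr)\cdot\mathtt{c}\bigl(\tfrac{\ell^{\cap}-1}{2};j\bigr).$$ (x) The number of pairs $(A,B)\in\mathcal{F}$ with $\{1,t\}\cap A=\{1,t\}\cap B=\{t\}$ is $$\mathfrak{F}\left(\theta,\gamma;\tfrac{\ell+1}{2},\tfrac{\ell'-1}{2},\tfrac{\ell''-1}{2},\tfrac{\ell^{\cap}+1}{2}\right)\cdot\mathtt{c}\bigl(\tfrac{\ell+1}{2};n\bigr)\cdot\mathtt{c}\bigl(\tfrac{\ell'-1}{2};j'-j\bigr)\cdot\mathtt{c}\bigl(\tfrac{\ell''-1}{2};j''-j\bigr)\cdot\mathtt{c}\bigl(\tfrac{\ell^{\cap}+1}{2};j\bigr).$$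
   Context: The distinguished symmetric cycle $\boldsymbol{R}$ of the hypercube graph on $\{1,-1\}^t$ has vertices $R^0,\ldots,R^{2t-1}$, where $R^0=(1,\ldots,1)$; for $1\le s\le t-1$, $R^s\in\{1,-1\}^t$ has entries $-1$ exactly in positions $1,\ldots,s$; and $R^{k+t}=-R^k$ for $0\le k\le t-1$. The vectors $R^0,\ldots,R^{t-1}$ form a basis of $\mathbb{R}^t$, and for every $T\in\{1,-1\}^t$ there is a unique $\boldsymbol{x}=(x_1,\ldots,x_t)\in\{-1,0,1\}^t$ with $T=\sum_{i=1}^t x_iR^{i-1}$. Put $\boldsymbol{Q}(T,\boldsymbol{R})=\{x_iR^{i-1}\colon x_i\ne 0\}$; it is the unique inclusion-minimal subset of $\{R^0,\ldots,R^{2t-1}\}$ with sum $T$, and it has odd cardinality. For $A\subseteq E_t=\{1,\ldots,t\}$, ${}_{-A}\mathrm{T}^{(+)}$ is the vector in $\{1,-1\}^t$ whose set of coordinates equal to $-1$ is $A$, and $\mathfrak{q}(A)=|\boldsymbol{Q}({}_{-A}\mathrm{T}^{(+)},\boldsymbol{R})|$, i.e. the number of nonzero entries of the corresponding $\boldsymbol{x}$. $\mathtt{c}(m;n)=\binom{n-1}{m-1}$ is the number of compositions of the positive integer $n$ with $m$ positive parts (so $\mathtt{c}(0;n)=0$). A Smirnov word is a word in which any two adjacent letters differ. For $\mathfrak{s}',\mathfrak{s}''\in\{\theta,\alpha,\beta,\gamma\}$, $\mathfrak{F}(\mathfrak{s}',\mathfrak{s}'';k,i,j,h)$ is the number of Smirnov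 words over the four-letter alphabet $(\theta,\alpha,\beta,\gamma)$ that contain exactly $k$ letters $\theta$, $i$ letters $\alpha$, $j$ letters $\beta$ and $h$ letters $\gamma$ (Parikh vector $(k,i,j,h)$), start with the letter $\mathfrak{s}'$ and end with the letter $\mathfrak{s}''$. *)

theory Defs
  imports Complex_Main
begin

text \<open>
  Vectors of \<open>\<real>\<^sup>t\<close> are functions \<open>nat \<Rightarrow> real\<close> that vanish outside the
  index set \<open>{1..t}\<close>, so that distinct vectors are distinct functions and sets of vectors
  have the intended cardinality.
\<close>

definition vecs :: "nat \<Rightarrow> real set \<Rightarrow> (nat \<Rightarrow> real) set" where
  "vecs t D = {v. (\<forall>e\<in>{1..t}. v e \<in> D) \<and> (\<forall>e. e \<notin> {1..t} \<longrightarrow> v e = 0)}"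

text \<open>\<open>sym_cycle t k\<close> is the vertex \<open>R\<^sup>k\<close>, for \<open>0 \<le> k \<le> 2t - 1\<close>.\<close>

definition sym_cycle :: "nat \<Rightarrow> nat \<Rightarrow> nat \<Rightarrow> real" where
  "sym_cycle t k e =
     (if e \<notin> {1..t} then 0
      else if k < t then (if e \<le> k then -1 else 1)
      else - (if e \<le> k - t then -1 else 1))"

definition decomp :: "nat \<Rightarrow> (nat \<Rightarrow> real) \<Rightarrow> nat \<Rightarrow> real" where
  "decomp t T = (THE x. x \<in> vecs t {-1, 0, 1} \<and>
     T = (\<lambda>e. \<Sum>i=1..t. x i * sym_cycle t (i - 1) e))"

definition Q_set :: "nat \<Rightarrow> (nat \<Rightarrow> real) \<Rightarrow> (nat \<Rightarrow> real) set" where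
  "Q_set t T = {(\<lambda>e. decomp t T i * sym_cycle t (i - 1) e) | i. i \<in> {1..t} \<and> decomp t T i \<noteq> 0}"

definition neg_tope :: "nat \<Rightarrow> nat set \<Rightarrow> nat \<Rightarrow> real" where
  "neg_tope t A e = (if e \<notin> {1..t} then 0 else if e \<in> A then -1 else 1)"

definition q :: "nat \<Rightarrow> nat set \<Rightarrow> nat" where
  "q t A = card (Q_set t (neg_tope t A))"

definition compositions :: "nat \<Rightarrow> nat \<Rightarrow> nat" where
  "compositions m n = (if m = 0 then 0 else (n - 1) choose (m - 1))"

datatype letter = Theta | Alpha | Beta | Gamma

definition smirnov_words ::
    "letter \<Rightarrow> letter \<Rightarrow> nat \<Rightarrow> nat \<Rightarrow> nat \<Rightarrow> nat \<Rightarrow> letter list set" where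
  "smirnov_words s' s'' k i j h =
     {w. distinct_adj w \<and> w \<noteq> [] \<and> hd w = s' \<and> last w = s'' \<and>
         count_list w Theta = k \<and> count_list w Alpha = i \<and>
         count_list w Beta = j \<and> count_list w Gamma = h}"

definition smirnov :: "letter \<Rightarrow> letter \<Rightarrow> nat \<Rightarrow> nat \<Rightarrow> nat \<Rightarrow> nat \<Rightarrow> nat" where
  "smirnov s' s'' k i j h = card (smirnov_words s' s'' k i j h)"

definition family ::
    "nat \<Rightarrow> nat \<Rightarrow> nat \<Rightarrow> nat \<Rightarrow> nat \<Rightarrow> nat \<Rightarrow> nat \<Rightarrow> nat \<Rightarrow> (nat set \<times> nat set) set" where
  "family t j' j'' j l' l'' l_cap l =
     {(A, B). A \<subseteq> {1..t} \<and> B \<subseteq> {1..t} \<and>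
        card A = j' \<and> j' < t \<and> card B = j'' \<and> j'' < t \<and>
        0 < card (A \<inter> B) \<and> card (A \<inter> B) = j \<and>
        max j' j'' < card (A \<union> B) \<and> card (A \<union> B) < t \<and>
        q t (A - B) = l' \<and> q t (B - A) = l'' \<and> q t (A \<inter> B) = l_cap \<and> q t (A \<union> B) = l}"

lemma sum_sym_cycle:
  assumes "e \<in> {1..t}"
  shows "(\<Sum>i=1..t. x i * sym_cycle t (i - 1) e) = 2 * (\<Sum>i=1..e. x i) - (\<Sum>i=1..t. x i)"
proof -
  have "(\<Sum>i=1..t. x i * sym_cycle t (i - 1) e) = (\<Sum>i=1..t. 2 * (if i \<in> {1..e} then x i else 0) - x i)"
    by (rule sum.cong) (use assms in \<open>auto simp: sym_cycle_def\<close>)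
  also have "\<dots> = 2 * (\<Sum>i=1..t. if i \<in> {1..e} then x i else 0) - (\<Sum>i=1..t. x i)"
    by (simp only: sum_subtractf sum_distrib_left)
  also have "(\<Sum>i=1..t. if i \<in> {1..e} then x i else 0) = (\<Sum>i\<in>{1..t} \<inter> {1..e}. x i)"
    by (rule sum.inter_restrict[symmetric]) simp
  also have "{1..t} \<inter> {1..e} = {1..e}" using assms by auto
  finally show ?thesis .
qed

theorem decomp_ex1:
  assumes "t \<ge> 1" and T: "T \<in> vecs t {-1, 1}"
  shows "\<exists>!x. x \<in> vecs t {-1, 0, 1} \<and> T = (\<lambda>e. \<Sum>i=1..t. x i * sym_cycle t (i - 1) e)"
proof -
  define y where "y i = (if i \<notin> {1..t} then 0 else if i = 1 then (T 1 + T t) / 2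
                         else (T i - T (i - 1)) / 2)" for i
  have val: "T e = -1 \<or> T e = 1" if "e \<in> {1..t}" for e
    using T that by (auto simp: vecs_def)
  have T0: "T e = 0" if "e \<notin> {1..t}" for e
    using T that by (auto simp: vecs_def)
  have "y i \<in> {-1, 0, 1}" if "i \<in> {1..t}" for i
  proof (cases "i = 1")
    case True
    then show ?thesis using val[of 1] val[of t] assms(1) by (auto simp: y_def)
  next
    case False
    then have "i - 1 \<in> {1..t}" using that by auto
    then show ?thesis using val[of i] val[of "i - 1"] that False by (auto simp: y_def)
  qed
  then have y_in: "y \<in> vecs t {-1, 0, 1}"
    by (auto simp: vecs_def y_def)
  have pre: "(\<Sum>i=1..e. y i) = (T e + T t) / 2" if "1 \<le> e" "e \<le> t" for e
    using that
  proof (induction e rule: dec_induct)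
    case base
    then show ?case by (simp add: y_def)
  next
    case (step k)
    then show ?case by (simp add: y_def field_simps)
  qed
  have y_sum: "T = (\<lambda>e. \<Sum>i=1..t. y i * sym_cycle t (i - 1) e)"
  proof
    fix e
    show "T e = (\<Sum>i=1..t. y i * sym_cycle t (i - 1) e)"
    proof (cases "e \<in> {1..t}")
      case True
      then show ?thesis
        using pre[of e] pre[of t] assms(1) by (simp only: sum_sym_cycle) (simp add: field_simps)
    next
      case False
      then show ?thesis using T0[OF False] by (simp add: sym_cycle_def)
    qed
  qed
  have "x = y" if x: "x \<in> vecs t {-1, 0, 1}"
    and xs: "T = (\<lambda>e. \<Sum>i=1..t. x i * sym_cycle t (i - 1) e)" for x
  proof
    fix i
    have S: "T e = 2 * (\<Sum>i=1..e. x i) - (\<Sum>i=1..t. x i)" if "e \<in> {1..t}" for e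
      using fun_cong[OF xs, of e] sum_sym_cycle[OF that, of x] by simp
    consider "i \<notin> {1..t}" | "i = 1" | k where "i = Suc k" "k \<in> {1..t}" "Suc k \<in> {1..t}"
      by (cases i) force+
    then show "x i = y i"
    proof cases
      case 1
      then show ?thesis using x by (auto simp: vecs_def y_def)
    next
      case 2
      then show ?thesis using S[of 1] S[of t] assms(1) by (simp add: y_def)
    next
      case 3
      then show ?thesis using S[of k] S[of "Suc k"] by (simp add: y_def)
    qed
  qed
  with y_in y_sum show ?thesis by blast
qed

lemma neg_tope_in_vecs: "neg_tope t A \<in> vecs t {-1, 1}"
  by (auto simp: vecs_def neg_tope_def)

theorem q_eq_card_nonzero:
  assumes "t \<ge> 1"
  shows "q t A = card {i \<in> {1..t}. decomp t (neg_tope t A) i \<noteq> 0}"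
proof -
  define x where "x = decomp t (neg_tope t A)"
  have "x \<in> vecs t {-1, 0, 1}"
    using theI'[OF decomp_ex1[OF assms neg_tope_in_vecs[of t A]]]
    by (simp add: x_def decomp_def)
  then have x: "x i \<in> {-1, 0, 1}" if "i \<in> {1..t}" for i
    using that by (auto simp: vecs_def)
  define f where "f i = (\<lambda>e. x i * sym_cycle t (i - 1) e)" for i
  have neq: "f i \<noteq> f k" if "i \<in> {1..t}" "k \<in> {1..t}" "i < k" "x i \<noteq> 0" "x k \<noteq> 0" for i k
  proof
    assume "f i = f k"
    then have "f i i = f k i" "f i t = f k t" by simp_all
    moreover have "f i i = x i" "f k i = - x k" "f i t = x i" "f k t = x k"
      using that by (auto simp: f_def sym_cycle_def)
    ultimately show False using that by simp
  qed
  have "inj_on f {i \<in> {1..t}. x i \<noteq> 0}"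
  proof (rule inj_onI)
    fix i k assume "i \<in> {i \<in> {1..t}. x i \<noteq> 0}" "k \<in> {i \<in> {1..t}. x i \<noteq> 0}" "f i = f k"
    then show "i = k" using neq[of i k] neq[of k i] by (cases i k rule: linorder_cases) auto
  qed
  moreover have "Q_set t (neg_tope t A) = f ` {i \<in> {1..t}. x i \<noteq> 0}"
    by (auto simp: Q_set_def f_def x_def)
  ultimately show ?thesis
    by (simp add: q_def card_image x_def)
qed

theorem card_compositions:
  assumes "n \<ge> 1"
  shows "card {ns. length ns = m \<and> (\<forall>a\<in>set ns. 0 < a) \<and> sum_list ns = n} = compositions m n"
    (is "card ?C = _")
proof -
  have sum_Suc: "sum_list (map Suc l) = sum_list l + length l" for l
    by (induction l) auto
  have eq: "?C = map Suc ` {l. length l = m \<and> sum_list l + m = n}"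
  proof (intro equalityI subsetI)
    fix ns assume ns: "ns \<in> ?C"
    define l where "l = map (\<lambda>a. a - 1) ns"
    have "map Suc l = ns" using ns by (auto simp: l_def intro: map_idI)
    moreover have "length l = m" using ns by (simp add: l_def)
    ultimately show "ns \<in> map Suc ` {l. length l = m \<and> sum_list l + m = n}"
      using ns sum_Suc[of l] by auto
  qed (auto simp: sum_Suc)
  have "inj_on (map Suc) X" for X by (simp add: inj_on_def inj_map_eq_map)
  then have card_eq: "card ?C = card {l. length l = m \<and> sum_list l + m = n}"
    unfolding eq by (rule card_image)
  show ?thesis
  proof (cases "m = 0")
    case True
    then show ?thesis using assms by (simp add: compositions_def)
  next
    case m: False
    show ?thesis
    proof (cases "m \<le> n")
      case True
      have "{l::nat list. length l = m \<and> sum_list l + m = n} = {l. size l = m \<and> sum_list l = n - m}"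
        using True by auto
      then have "card ?C = (n - m + m - 1) choose (n - m)"
        using card_eq card_length_sum_list[of m "n - m"] by simp
      also have "\<dots> = (n - 1) choose ((n - 1) - (m - 1))"
        using True m by simp
      also have "\<dots> = (n - 1) choose (m - 1)"
        by (rule binomial_symmetric[symmetric]) (use True in simp)
      finally show ?thesis using m by (simp add: compositions_def)
    next
      case False
      then have "{l::nat list. length l = m \<and> sum_list l + m = n} = {}" by auto
      then show ?thesis using card_eq m False assms by (simp add: compositions_def binomial_eq_0)
    qed
  qed
qed

end

theory Submission
  imports Defs
begin

text \<open>
  A pair of subsets of \<open>{1..t}\<close> is a word of length \<open>t\<close> over four letters: the letter at
  position \<open>e\<close> records in which of the two sets \<open>e\<close> lies, with \<open>\<theta>\<close> for neither, \<open>\<alpha>\<close> for the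
  first only, \<open>\<beta>\<close> for the second only and \<open>\<gamma>\<close> for both (\<open>bij_betw_word_of\<close>). Every condition
  that defines the family then becomes a condition on the maximal runs of equal letters.

  The cardinalities of the sets fix how often each letter occurs. The numbers \<open>q\<close> fix
  how many runs each letter has. Indeed, solving for the coefficients gives
  \<open>x\<^sub>1 = (T\<^sub>1 + T\<^sub>t) / 2\<close> and \<open>x\<^sub>i = (T\<^sub>i - T\<^sub>i\<^sub>-\<^sub>1) / 2\<close> for \<open>i \<ge> 2\<close>, so \<open>q t S\<close> is the number of
  places inside the word where membership in \<open>S\<close> changes, plus one if \<open>1\<close> and \<open>t\<close> lie on the
  same side (\<open>q_eq_switches\<close>). A run of a letter contributes two changes, except that a
  run at an end of the word lacks one (\<open>twice_count_runs\<close>). Hence a letter has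
  \<open>(m + 1) / 2\<close> runs if it stands at an end of the word, and \<open>(m - 1) / 2\<close> runs otherwise,
  where \<open>m\<close> is the value of \<open>q\<close> on the set of its positions
  (\<open>q_eq_iff_count_runs\<close>). For \<open>\<theta>\<close> the set \<open>A \<union> B\<close> is the complement of the set of positions,
  which changes neither the switches nor the comparison of the two ends.

  Collapsing each run to one letter gives a Smirnov word with the prescribed first letter,
  last letter and numbers of runs. The words over one Smirnov word are obtained by
  choosing run lengths, that is, independently for each letter, a composition of its number of
  occurrences into as many parts as it has runs (\<open>card_words_over\<close>). This number depends on the
  Smirnov word only through its Parikh vector, so the count is a product
  (\<open>card_family_with_ends\<close>), and the ten claims are ten choices of the two end letters.
\<close>

section \<open>Words with a prescribed sequence of runs\<close>

text \<open>
  The number of compositions of \<open>n\<close> into \<open>m\<close> positive parts, with the empty composition of \<open>0\<close>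
  included. That value makes the recursion \<open>parts_Suc_Suc\<close> (decrease the first part, or remove
  it if it is \<open>1\<close>) hold down to \<open>n = 0\<close>, where \<open>compositions\<close> does not satisfy it.
\<close>

definition parts :: "nat \<Rightarrow> nat \<Rightarrow> nat" where
  "parts m n = (if n = 0 then of_bool (m = 0) else compositions m n)"

lemma parts_0_Suc: "parts 0 (Suc n) = 0"
  by (simp add: parts_def compositions_def)

lemma parts_Suc_0: "parts (Suc m) 0 = 0"
  by (simp add: parts_def)

lemma parts_Suc_Suc: "parts (Suc m) (Suc n) = parts (Suc m) n + parts m n"
  by (cases m; cases n) (auto simp: parts_def compositions_def)

definition words_over :: "'a list \<Rightarrow> ('a \<Rightarrow> nat) \<Rightarrow> 'a list set" where
  "words_over s N = {w. remdups_adj w = s \<and> (\<forall>c. count_list w c = N c)}"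

lemma length_eq_sum_counts:
  fixes w :: "'a::finite list"
  shows "length w = (\<Sum>c\<in>UNIV. count_list w c)"
proof -
  have "(\<Sum>c\<in>UNIV. count_list w c) = (\<Sum>c\<in>set w. count_list w c)"
    by (rule sum.mono_neutral_right) (auto simp: count_list_0_iff)
  then show ?thesis by (simp add: sum_count_set)
qed

lemma finite_words_with_counts:
  fixes N :: "'a::finite \<Rightarrow> nat"
  shows "finite {w. \<forall>c. count_list w c = N c}"
proof (rule finite_subset)
  show "{w. \<forall>c. count_list w c = N c} \<subseteq> {w. set w \<subseteq> UNIV \<and> length w = sum N UNIV}"
    by (auto simp: length_eq_sum_counts)
  show "finite {w::'a list. set w \<subseteq> UNIV \<and> length w = sum N UNIV}"
    by (rule finite_lists_length_eq) simp
qed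

text \<open>Deleting the first letter of a word shortens its first run or, if that run has length one,
  removes it.\<close>

lemma remdups_adj_Cons_eq_Cons:
  assumes "distinct_adj (c # s)"
  shows "remdups_adj (c # w) = c # s \<longleftrightarrow> remdups_adj w = c # s \<or> remdups_adj w = s"
  using assms by (cases s) (auto simp: remdups_adj_Cons split: list.splits)

lemma words_over_Cons:
  assumes "distinct_adj (c # s)" and "N c = Suc n"
  shows "words_over (c # s) N
    = Cons c ` (words_over (c # s) (N(c := n)) \<union> words_over s (N(c := n)))"
proof (intro equalityI subsetI)
  fix w assume w: "w \<in> words_over (c # s) N"
  then have "w \<noteq> []" by (auto simp: words_over_def)
  then obtain d v where dv: "w = d # v" by (cases w) auto
  with w have "d = c" by (auto simp: words_over_def remdups_adj_Cons split: list.splits if_splits)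
  with dv have v: "w = c # v" by simp
  have "count_list v d = (N(c := n)) d" for d
    using w assms(2) v by (auto simp: words_over_def split: if_splits)
  then show "w \<in> Cons c ` (words_over (c # s) (N(c := n)) \<union> words_over s (N(c := n)))"
    using w v remdups_adj_Cons_eq_Cons[OF assms(1), of v] by (auto simp: words_over_def)
next
  fix w assume "w \<in> Cons c ` (words_over (c # s) (N(c := n)) \<union> words_over s (N(c := n)))"
  then show "w \<in> words_over (c # s) N"
    using remdups_adj_Cons_eq_Cons[OF assms(1)] assms(2)
    by (auto simp: words_over_def simp del: remdups_adj.simps)
qed

text \<open>
  Deleting the first letter satisfies the same recursion on the words as \<open>parts\<close> does in
  the factor of that letter, the other factors being unaffected. The induction is on the length
  of the words, since shortening the first run leaves \<open>s\<close> unchanged.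
\<close>

lemma card_words_over:
  fixes N :: "'a::finite \<Rightarrow> nat"
  assumes "distinct_adj s"
  shows "card (words_over s N) = (\<Prod>c\<in>UNIV. parts (count_list s c) (N c))"
  using assms
proof (induction "sum N UNIV" arbitrary: s N)
  case 0
  then have N: "N c = 0" for c by simp
  have "words_over s N = (if s = [] then {[]} else {})"
    by (auto simp: words_over_def N count_list_0_iff)
  moreover have "(\<Prod>c\<in>UNIV. parts (count_list s c) (N c)) = of_bool (s = [])"
  proof (cases s)
    case (Cons c v)
    then show ?thesis by (auto simp: N intro!: exI[of _ c] parts_Suc_0)
  qed (simp add: N parts_def)
  ultimately show ?case by simp
next
  case (Suc k)
  show ?case
  proof (cases s)
    case Nil
    obtain c n where "N c = Suc n"
      using Suc.hyps(2) by (metis nat.exhaust sum.neutral nat.distinct(1))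
    then have "parts (count_list s c) (N c) = 0"
      using Nil by (simp add: parts_0_Suc)
    then have "(\<Prod>c\<in>UNIV. parts (count_list s c) (N c)) = 0"
      by (auto simp: prod_zero_iff)
    moreover have "words_over s N = {}"
      using Nil \<open>N c = Suc n\<close> by (auto simp: words_over_def intro!: exI[of _ c])
    ultimately show ?thesis by simp
  next
    case (Cons c v)
    show ?thesis
    proof (cases "N c")
      case 0
      then have "words_over s N = {}"
        using Cons by (auto simp: words_over_def count_list_0_iff
            intro!: exI[of _ c] dest!: arg_cong[where f = set])
      then show ?thesis using 0 Cons by (auto intro!: exI[of _ c] parts_Suc_0)
    next
      case (Suc n)
      define N' where "N' = N(c := n)"
      have dist: "distinct_adj (c # v)" "distinct_adj v"
        using Suc.prems Cons by (auto dest: distinct_adj_ConsD)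
      \<comment> \<open>The total number of letters drops by one, so the induction hypothesis applies to \<open>N'\<close>.\<close>
      have "sum N UNIV = N c + sum N (UNIV - {c})" "sum N' UNIV = N' c + sum N' (UNIV - {c})"
        by (simp_all add: sum.remove)
      moreover have "sum N' (UNIV - {c}) = sum N (UNIV - {c})"
        by (rule sum.cong) (auto simp: N'_def)
      ultimately have k: "k = sum N' UNIV"
        using Suc.hyps(2) \<open>N c = Suc n\<close> by (simp add: N'_def)
      have fin: "finite (words_over u N')" for u
        by (rule finite_subset[OF _ finite_words_with_counts[of N']]) (auto simp: words_over_def)
      have "card (words_over s N) = card (words_over (c # v) N' \<union> words_over v N')"
        unfolding Cons words_over_Cons[of c v N n, OF dist(1) \<open>N c = Suc n\<close>] N'_def
        by (rule card_image) simp
      also have "\<dots> = card (words_over (c # v) N') + card (words_over v N')"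
        by (rule card_Un_disjoint) (use fin in \<open>auto simp: words_over_def\<close>)
      also have "\<dots> = (\<Prod>d\<in>UNIV. parts (count_list (c # v) d) (N' d))
          + (\<Prod>d\<in>UNIV. parts (count_list v d) (N' d))"
        using Suc.hyps(1)[OF k] dist by simp
      also have "\<dots> = (parts (Suc (count_list v c)) n + parts (count_list v c) n)
          * (\<Prod>d\<in>UNIV - {c}. parts (count_list v d) (N d))"
        by (simp add: prod.remove[of _ c] N'_def algebra_simps)
      also have "\<dots> = parts (count_list s c) (N c)
          * (\<Prod>d\<in>UNIV - {c}. parts (count_list s d) (N d))"
        by (simp add: Cons \<open>N c = Suc n\<close> parts_Suc_Suc)
      finally show ?thesis by (simp add: prod.remove[of _ c])
    qed
  qed
qed

text \<open>The factor \<open>card X\<close> splits off because the number of words over \<open>s\<close> depends only on the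
  letter counts of \<open>s\<close>, which are the same throughout \<open>X\<close>.\<close>

lemma card_words_with_run_pattern:
  fixes N r :: "'a::finite \<Rightarrow> nat"
  assumes "\<And>s. s \<in> X \<Longrightarrow> distinct_adj s \<and> (\<forall>c. count_list s c = r c)"
  shows "card {w. remdups_adj w \<in> X \<and> (\<forall>c. count_list w c = N c)}
    = card X * (\<Prod>c\<in>UNIV. parts (r c) (N c))"
proof -
  have finX: "finite X"
    by (rule finite_subset[OF _ finite_words_with_counts[of r]]) (use assms in auto)
  have fin: "finite (words_over s N)" for s
    by (rule finite_subset[OF _ finite_words_with_counts[of N]]) (auto simp: words_over_def)
  have "{w. remdups_adj w \<in> X \<and> (\<forall>c. count_list w c = N c)} = (\<Union>s\<in>X. words_over s N)"
    by (auto simp: words_over_def)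
  also have "card \<dots> = (\<Sum>s\<in>X. card (words_over s N))"
    by (rule card_UN_disjoint) (use finX fin in \<open>auto simp: words_over_def\<close>)
  also have "\<dots> = (\<Sum>s\<in>X. \<Prod>c\<in>UNIV. parts (r c) (N c))"
    by (rule sum.cong) (use assms in \<open>auto simp: card_words_over\<close>)
  finally show ?thesis by simp
qed

section \<open>Runs and the size of a decomposition\<close>

text \<open>Each run has two boundaries. Those inside the word are switches; those missing from the
  switches are at the two ends of the word.\<close>

lemma twice_count_runs:
  assumes "w \<noteq> []"
  shows "2 * count_list (remdups_adj w) c
    = (\<Sum>i<length w - 1. of_bool ((w ! i = c) \<noteq> (w ! Suc i = c)))
      + of_bool (hd w = c) + of_bool (last w = c)"
  using assms
proof (induction w rule: induct_list012)
  case (3 x y zs)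
  have "(\<Sum>i<length (x # y # zs) - 1.
          of_bool (((x # y # zs) ! i = c) \<noteq> ((x # y # zs) ! Suc i = c)) :: nat)
      = of_bool ((x = c) \<noteq> (y = c))
        + (\<Sum>i<length (y # zs) - 1. of_bool (((y # zs) ! i = c) \<noteq> ((y # zs) ! Suc i = c)))"
    by (simp add: sum.lessThan_Suc_shift del: sum.lessThan_Suc sum_of_bool_eq)
  moreover have "2 * count_list (remdups_adj (x # y # zs)) c
      = 2 * count_list (remdups_adj (y # zs)) c + 2 * of_bool (x = c \<and> y \<noteq> c)"
    by simp
  ultimately show ?case using "3.IH"(2) by (auto simp del: remdups_adj.simps)
qed auto

text \<open>Consecutive coordinates of \<open>\<Sum> x\<^sub>i R\<^sup>i\<^sup>-\<^sup>1\<close> differ by \<open>2 x\<^sub>i\<close>, and its last coordinate is the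
  sum of all \<open>x\<^sub>i\<close>.\<close>

lemma decomp_neg_tope:
  assumes "t \<ge> 1"
  shows "decomp t (neg_tope t S) 1 = (neg_tope t S 1 + neg_tope t S t) / 2"
    and "\<lbrakk>1 \<le> i; Suc i \<le> t\<rbrakk>
      \<Longrightarrow> decomp t (neg_tope t S) (Suc i) = (neg_tope t S (Suc i) - neg_tope t S i) / 2"
proof -
  define T where "T = neg_tope t S"
  define x where "x = decomp t T"
  have "T = (\<lambda>e. \<Sum>i=1..t. x i * sym_cycle t (i - 1) e)"
    using theI'[OF decomp_ex1[OF assms neg_tope_in_vecs[of t S]]]
    by (simp add: x_def T_def decomp_def)
  then have T: "T e = 2 * (\<Sum>i=1..e. x i) - (\<Sum>i=1..t. x i)" if "e \<in> {1..t}" for e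
    using sum_sym_cycle[OF that, of x] by metis
  show "decomp t (neg_tope t S) 1 = (neg_tope t S 1 + neg_tope t S t) / 2"
    using T[of 1] T[of t] assms by (simp flip: T_def x_def)
  show "decomp t (neg_tope t S) (Suc i) = (neg_tope t S (Suc i) - neg_tope t S i) / 2"
    if "1 \<le> i" "Suc i \<le> t"
    using T[of i] T[of "Suc i"] that by (simp flip: T_def x_def)
qed

lemma q_eq_switches:
  assumes "t \<ge> 1"
  shows "q t S = (\<Sum>i<t - 1. of_bool ((Suc i \<in> S) \<noteq> (Suc (Suc i) \<in> S)))
    + of_bool ((1 \<in> S) = (t \<in> S))"
proof -
  let ?x = "decomp t (neg_tope t S)"
  have "q t S = (\<Sum>i=1..t. of_bool (?x i \<noteq> 0))"
    by (simp add: q_eq_card_nonzero[OF assms] Int_def)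
  also have "{1..t} = Suc ` {..<t}"
    by (simp add: lessThan_atLeast0 image_Suc_atLeastLessThan atLeastLessThanSuc_atLeastAtMost)
  also have "(\<Sum>i\<in>Suc ` {..<t}. of_bool (?x i \<noteq> 0)) = (\<Sum>i<Suc (t - 1). of_bool (?x (Suc i) \<noteq> 0))"
    using assms by (simp add: sum.reindex)
  also have "\<dots> = of_bool (?x 1 \<noteq> 0) + (\<Sum>i<t - 1. of_bool (?x (Suc (Suc i)) \<noteq> 0))"
    by (simp add: sum.lessThan_Suc_shift del: sum.lessThan_Suc sum_of_bool_eq)
  also have "?x 1 \<noteq> 0 \<longleftrightarrow> (1 \<in> S) = (t \<in> S)"
    unfolding decomp_neg_tope(1)[OF assms] using assms by (simp add: neg_tope_def)
  also have "(\<Sum>i<t - 1. of_bool (?x (Suc (Suc i)) \<noteq> 0) :: nat)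
      = (\<Sum>i<t - 1. of_bool ((Suc i \<in> S) \<noteq> (Suc (Suc i) \<in> S)))"
    by (rule sum.cong) (use assms in \<open>auto simp: decomp_neg_tope(2) neg_tope_def\<close>)
  finally show ?thesis by simp
qed

text \<open>
  With switches expressed by runs, \<open>q t S\<close> is \<open>2 r + 1\<close> if \<open>c\<close> stands at neither end of the
  word and \<open>2 r - 1\<close> if it stands at one or both ends, where \<open>r\<close> is the number of runs of \<open>c\<close>:
  in passing from one end to both, the gain of the extra term of \<open>q\<close> offsets the loss of a switch.
  The complement of the set of positions is admitted because \<open>A \<union> B\<close> is the complement of the
  positions of \<open>\<theta>\<close>.
\<close>

lemma q_eq_iff_count_runs:
  assumes "t \<ge> 1" and "length w = t" and "odd l"
    and S: "(\<forall>i<t. Suc i \<in> S \<longleftrightarrow> w ! i = c) \<or> (\<forall>i<t. Suc i \<in> S \<longleftrightarrow> w ! i \<noteq> c)"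
  shows "q t S = l \<longleftrightarrow> count_list (remdups_adj w) c
    = (if c \<in> {hd w, last w} then l + 1 else l - 1) div 2"
proof -
  have "w \<noteq> []" using assms by auto
  then have ends: "hd w = w ! 0" "last w = w ! (t - 1)"
    using assms(2) by (simp_all add: hd_conv_nth last_conv_nth)
  have "((1 \<in> S) = (t \<in> S)) = ((hd w = c) = (last w = c))"
  proof -
    have "0 < t" "t - 1 < t" "Suc (t - 1) = t" using assms(1) by auto
    then show ?thesis using S unfolding ends by (metis One_nat_def)
  qed
  moreover have "(\<Sum>i<t - 1. of_bool ((Suc i \<in> S) \<noteq> (Suc (Suc i) \<in> S)) :: nat)
      = (\<Sum>i<t - 1. of_bool ((w ! i = c) \<noteq> (w ! Suc i = c)))"
  proof (rule sum.cong)
    fix i assume "i \<in> {..<t - 1}"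
    then have "i < t" "Suc i < t" by auto
    then show "(of_bool ((Suc i \<in> S) \<noteq> (Suc (Suc i) \<in> S)) :: nat)
      = of_bool ((w ! i = c) \<noteq> (w ! Suc i = c))" using S by auto
  qed simp
  ultimately have "q t S + of_bool (hd w = c) + of_bool (last w = c)
      = 2 * count_list (remdups_adj w) c + of_bool ((hd w = c) = (last w = c))"
    using twice_count_runs[OF \<open>w \<noteq> []\<close>, of c] assms(2)
    by (simp add: q_eq_switches[OF assms(1)])
  then show ?thesis using \<open>odd l\<close> by (auto elim!: oddE split: if_splits)
qed

section \<open>Pairs of sets as words\<close>

lemma UNIV_letter: "UNIV = {Theta, Alpha, Beta, Gamma}"
  using letter.exhaust by blast

instance letter :: finite
  by standard (simp add: UNIV_letter)

definition label :: "nat set \<Rightarrow> nat set \<Rightarrow> nat \<Rightarrow> letter" where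
  "label A B e = (if e \<in> A then if e \<in> B then Gamma else Alpha
                  else if e \<in> B then Beta else Theta)"

lemma label_eq_iff:
  "label A B e = Theta \<longleftrightarrow> e \<notin> A \<union> B" "label A B e = Alpha \<longleftrightarrow> e \<in> A - B"
  "label A B e = Beta \<longleftrightarrow> e \<in> B - A" "label A B e = Gamma \<longleftrightarrow> e \<in> A \<inter> B"
  by (auto simp: label_def)

definition word_of :: "nat \<Rightarrow> nat set \<times> nat set \<Rightarrow> letter list" where
  "word_of t = (\<lambda>(A, B). map (label A B) [1..<Suc t])"

lemma length_word_of: "length (word_of t P) = t"
  by (simp add: word_of_def split: prod.split)

lemma nth_word_of: "i < t \<Longrightarrow> word_of t (A, B) ! i = label A B (Suc i)"
  by (simp add: word_of_def del: upt_Suc)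

lemma bij_betw_word_of:
  "bij_betw (word_of t) (Pow {1..t} \<times> Pow {1..t}) {w. length w = t}"
proof (rule bij_betw_byWitness)
  let ?g = "\<lambda>w. ({e \<in> {1..t}. w ! (e - 1) \<in> {Alpha, Gamma}},
                  {e \<in> {1..t}. w ! (e - 1) \<in> {Beta, Gamma}})"
  have nth: "word_of t (A, B) ! (e - 1) = label A B e" if "e \<in> {1..t}" for A B e
    using nth_word_of[of "e - 1" t A B] that by auto
  show "\<forall>P\<in>Pow {1..t} \<times> Pow {1..t}. ?g (word_of t P) = P"
    by (auto simp: nth[simplified] label_eq_iff)
  show "\<forall>w\<in>{w. length w = t}. word_of t (?g w) = w"
  proof
    fix w :: "letter list" assume w: "w \<in> {w. length w = t}"
    show "word_of t (?g w) = w"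
    proof (rule nth_equalityI)
      fix i assume "i < length (word_of t (?g w))"
      then show "word_of t (?g w) ! i = w ! i"
        by (cases "w ! i") (auto simp: length_word_of nth_word_of label_def)
    qed (use w in \<open>simp add: length_word_of\<close>)
  qed
qed (auto simp: length_word_of)

lemma count_list_map_upt:
  "count_list (map f [1..<Suc t]) c = card {e \<in> {1..t}. f e = c}"
proof -
  have "count_list (map f xs) c = length (filter (\<lambda>e. f e = c) xs)" for xs
    by (induction xs) auto
  also have "length (filter (\<lambda>e. f e = c) [1..<Suc t]) = card {e \<in> {1..t}. f e = c}"
    by (subst distinct_card[symmetric]) (auto intro!: arg_cong[where f = card])
  finally show ?thesis .
qed

lemma count_word_of:
  assumes "A \<subseteq> {1..t}" "B \<subseteq> {1..t}"
  shows "count_list (word_of t (A, B)) Theta = t - card (A \<union> B)"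
    and "count_list (word_of t (A, B)) Alpha = card (A - B)"
    and "count_list (word_of t (A, B)) Beta = card (B - A)"
    and "count_list (word_of t (A, B)) Gamma = card (A \<inter> B)"
proof -
  have count: "count_list (word_of t (A, B)) c = card {e \<in> {1..t}. label A B e = c}" for c
    unfolding word_of_def by (simp only: prod.case count_list_map_upt)
  have "{e \<in> {1..t}. label A B e = Theta} = {1..t} - (A \<union> B)"
    by (auto simp: label_eq_iff)
  then show "count_list (word_of t (A, B)) Theta = t - card (A \<union> B)"
    using assms by (simp add: count card_Diff_subset finite_subset)
  have "{e \<in> {1..t}. label A B e = Alpha} = A - B" "{e \<in> {1..t}. label A B e = Beta} = B - A"
    "{e \<in> {1..t}. label A B e = Gamma} = A \<inter> B"
    using assms by (auto simp: label_eq_iff)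
  then show "count_list (word_of t (A, B)) Alpha = card (A - B)"
    "count_list (word_of t (A, B)) Beta = card (B - A)"
    "count_list (word_of t (A, B)) Gamma = card (A \<inter> B)"
    by (simp_all only: count)
qed

text \<open>The cardinality conditions on a pair amount to prescribing the sizes of the four blocks
  into which the pair partitions \<open>{1..t}\<close>, which are the letter counts of its word.\<close>

lemma card_pair_iff:
  fixes A B :: "nat set"
  assumes "finite A" "finite B" and "1 \<le> j" "j < min j' j''" and "j' + j'' - j < t"
  shows "card A = j' \<and> j' < t \<and> card B = j'' \<and> j'' < t \<and> 0 < card (A \<inter> B) \<and> card (A \<inter> B) = j
      \<and> max j' j'' < card (A \<union> B) \<and> card (A \<union> B) < t
    \<longleftrightarrow> t - card (A \<union> B) = t - (j' + j'' - j) \<and> card (A - B) = j' - j \<and> card (B - A) = j'' - j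
      \<and> card (A \<inter> B) = j"
proof -
  have "card A = card (A - B) + card (A \<inter> B)" "card B = card (B - A) + card (A \<inter> B)"
    "card A + card B = card (A \<union> B) + card (A \<inter> B)"
    using assms(1,2) card_Int_Diff[of A B] card_Int_Diff[of B A] card_Un_Int[of A B]
    by (simp_all add: Int_commute)
  then show ?thesis using assms(3-) by auto
qed

text \<open>
  The common form of the ten counts. A pair is determined by its word, and the condition that the
  word has its end letters \<open>a\<close> and \<open>b\<close> is what turns the four values of \<open>q\<close> into numbers of
  runs. All four blocks of the partition are nonempty, so \<open>parts\<close> can be replaced by
  \<open>compositions\<close>. The predicate \<open>P\<close> allows the end condition to be stated in terms of \<open>A\<close> and \<open>B\<close>.
\<close>

lemma card_family_with_ends:
  fixes t j' j'' j l' l'' l_cap l n :: nat and a b :: letter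
  assumes t: "t \<ge> 1" and j: "1 \<le> j" "j < min j' j''" "j' + j'' - j < t"
    and odd: "odd l'" "odd l''" "odd l_cap" "odd l"
    and n: "n = t - (j' + j'' - j)"
    and ends: "\<And>A B. P A B \<longleftrightarrow> label A B 1 = a \<and> label A B t = b"
  defines "r \<equiv> \<lambda>c m. (if c \<in> {a, b} then m + 1 else m - 1) div 2"
  shows "card {(A, B) \<in> family t j' j'' j l' l'' l_cap l. P A B}
    = smirnov a b (r Theta l) (r Alpha l') (r Beta l'') (r Gamma l_cap)
      * compositions (r Theta l) n * compositions (r Alpha l') (j' - j)
      * compositions (r Beta l'') (j'' - j) * compositions (r Gamma l_cap) j"
proof -
  have pos: "n \<noteq> 0" "j' - j \<noteq> 0" "j'' - j \<noteq> 0" "j \<noteq> 0"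
    using j by (auto simp: n)
  define N where "N = case_letter n (j' - j) (j'' - j) j"
  define runs where
    "runs = case_letter (r Theta l) (r Alpha l') (r Beta l'') (r Gamma l_cap)"
  define X where
    "X = smirnov_words a b (r Theta l) (r Alpha l') (r Beta l'') (r Gamma l_cap)"
  define W where "W = {w. remdups_adj w \<in> X \<and> (\<forall>c. count_list w c = N c)}"
  define F where
    "F = {(A, B) \<in> family t j' j'' j l' l'' l_cap l. label A B 1 = a \<and> label A B t = b}"
  have all_letters: "(\<forall>c. P c) \<longleftrightarrow> P Theta \<and> P Alpha \<and> P Beta \<and> P Gamma" for P
    by (metis letter.exhaust)
  have len: "length w = t" if "w \<in> W" for w
  proof -
    have "length w = (\<Sum>c\<in>UNIV. N c)"
      using that by (simp add: W_def length_eq_sum_counts)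
    then show ?thesis using j by (simp add: UNIV_letter N_def n)
  qed
  have iff: "(A, B) \<in> F \<longleftrightarrow> word_of t (A, B) \<in> W"
    if AB: "A \<subseteq> {1..t}" "B \<subseteq> {1..t}" for A B
  proof -
    define w where "w = word_of t (A, B)"
    have fin: "finite A" "finite B" using AB finite_subset by auto
    have w: "length w = t" by (simp add: w_def length_word_of)
    with t have "w \<noteq> []" by auto
    then have "hd w = w ! 0" "last w = w ! (t - 1)"
      by (simp_all add: hd_conv_nth last_conv_nth w)
    then have hd_last: "hd w = label A B 1" "last w = label A B t"
      using t by (simp_all add: w_def nth_word_of)
    have nth: "w ! i = label A B (Suc i)" if "i < t" for i
      using that by (simp add: w_def nth_word_of)
    have q: "q t (A \<union> B) = l \<longleftrightarrow> count_list (remdups_adj w) Theta = r Theta l"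
      "q t (A - B) = l' \<longleftrightarrow> count_list (remdups_adj w) Alpha = r Alpha l'"
      "q t (B - A) = l'' \<longleftrightarrow> count_list (remdups_adj w) Beta = r Beta l''"
      "q t (A \<inter> B) = l_cap \<longleftrightarrow> count_list (remdups_adj w) Gamma = r Gamma l_cap"
      if "hd w = a" "last w = b"
      unfolding r_def
      by (subst q_eq_iff_count_runs[OF t w];
          (simp add: that odd; fail | auto simp: nth label_eq_iff))+
    have counts: "(\<forall>c. count_list w c = N c) \<longleftrightarrow>
        card A = j' \<and> j' < t \<and> card B = j'' \<and> j'' < t \<and> 0 < card (A \<inter> B) \<and> card (A \<inter> B) = j
        \<and> max j' j'' < card (A \<union> B) \<and> card (A \<union> B) < t"
      unfolding card_pair_iff[OF fin j]
      using count_word_of[OF AB] by (simp add: all_letters w_def N_def n)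
    have "remdups_adj w \<in> X \<longleftrightarrow> label A B 1 = a \<and> label A B t = b
        \<and> q t (A - B) = l' \<and> q t (B - A) = l'' \<and> q t (A \<inter> B) = l_cap \<and> q t (A \<union> B) = l"
      using q \<open>w \<noteq> []\<close> by (auto simp: X_def smirnov_words_def hd_last)
    then show ?thesis
      using counts AB unfolding F_def W_def family_def w_def by auto
  qed
  have "bij_betw (word_of t) F W"
  proof (rule bij_betw_subset[OF bij_betw_word_of])
    show "F \<subseteq> Pow {1..t} \<times> Pow {1..t}" by (auto simp: F_def family_def)
    show "word_of t ` F = W"
    proof (intro equalityI subsetI)
      fix w assume "w \<in> word_of t ` F"
      then show "w \<in> W" using iff by (auto simp: F_def family_def)
    next
      fix w assume w: "w \<in> W"
      then have "w \<in> word_of t ` (Pow {1..t} \<times> Pow {1..t})"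
        using len bij_betw_imp_surj_on[OF bij_betw_word_of] by blast
      then show "w \<in> word_of t ` F" using w iff by auto
    qed
  qed
  then have "card F = card W" by (rule bij_betw_same_card)
  also have "\<dots> = card X * (\<Prod>c\<in>UNIV. parts (runs c) (N c))"
    unfolding W_def
    by (rule card_words_with_run_pattern)
      (auto simp: X_def smirnov_words_def runs_def all_letters)
  also have "(\<Prod>c\<in>UNIV. parts (runs c) (N c)) = compositions (r Theta l) n
      * (compositions (r Alpha l') (j' - j)
      * (compositions (r Beta l'') (j'' - j) * compositions (r Gamma l_cap) j))"
    using pos by (simp add: UNIV_letter runs_def N_def parts_def)
  finally show ?thesis by (simp add: ends F_def X_def smirnov_def)
qed

section \<open>The ten kinds of pairs\<close>

theorem theorem4p7:
  fixes t j' j'' j l' l'' l_cap l n :: nat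
  assumes "t \<ge> 3"
    and "j' \<ge> 1" and "j'' \<ge> 1" and "j \<ge> 1"
    and "j < min j' j''" and "j' + j'' - j < t"
    and "l' \<in> {1..t}" and "l'' \<in> {1..t}" and "l_cap \<in> {1..t}" and "l \<in> {1..t}"
    and "odd l'" and "odd l''" and "odd l_cap" and "odd l"
    and "n = t - (j' + j'' - j)"
  shows
   "card {(A, B) \<in> family t j' j'' j l' l'' l_cap l. {1, t} \<inter> A = {1} \<and> {1, t} \<inter> B = {1}} =
      smirnov Gamma Theta ((l + 1) div 2) ((l' - 1) div 2) ((l'' - 1) div 2) ((l_cap + 1) div 2)
      * compositions ((l + 1) div 2) n * compositions ((l' - 1) div 2) (j' - j)
      * compositions ((l'' - 1) div 2) (j'' - j) * compositions ((l_cap + 1) div 2) j \<and>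
    card {(A, B) \<in> family t j' j'' j l' l'' l_cap l. {1, t} \<inter> A = {1} \<and> {1, t} \<inter> B = {1, t}} =
      smirnov Gamma Beta ((l - 1) div 2) ((l' - 1) div 2) ((l'' + 1) div 2) ((l_cap + 1) div 2)
      * compositions ((l - 1) div 2) n * compositions ((l' - 1) div 2) (j' - j)
      * compositions ((l'' + 1) div 2) (j'' - j) * compositions ((l_cap + 1) div 2) j \<and>
    card {(A, B) \<in> family t j' j'' j l' l'' l_cap l. {1, t} \<inter> A = {1} \<and> card ({1, t} \<inter> B) = 0} =
      smirnov Alpha Theta ((l + 1) div 2) ((l' + 1) div 2) ((l'' - 1) div 2) ((l_cap - 1) div 2)
      * compositions ((l + 1) div 2) n * compositions ((l' + 1) div 2) (j' - j)
      * compositions ((l'' - 1) div 2) (j'' - j) * compositions ((l_cap - 1) div 2) j \<and>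
    card {(A, B) \<in> family t j' j'' j l' l'' l_cap l. {1, t} \<inter> A = {1} \<and> {1, t} \<inter> B = {t}} =
      smirnov Alpha Beta ((l - 1) div 2) ((l' + 1) div 2) ((l'' + 1) div 2) ((l_cap - 1) div 2)
      * compositions ((l - 1) div 2) n * compositions ((l' + 1) div 2) (j' - j)
      * compositions ((l'' + 1) div 2) (j'' - j) * compositions ((l_cap - 1) div 2) j \<and>
    card {(A, B) \<in> family t j' j'' j l' l'' l_cap l. {1, t} \<inter> A = {1, t} \<and> {1, t} \<inter> B = {1, t}} =
      smirnov Gamma Gamma ((l - 1) div 2) ((l' - 1) div 2) ((l'' - 1) div 2) ((l_cap + 1) div 2)
      * compositions ((l - 1) div 2) n * compositions ((l' - 1) div 2) (j' - j)
      * compositions ((l'' - 1) div 2) (j'' - j) * compositions ((l_cap + 1) div 2) j \<and>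
    card {(A, B) \<in> family t j' j'' j l' l'' l_cap l. {1, t} \<inter> A = {1, t} \<and> card ({1, t} \<inter> B) = 0} =
      smirnov Alpha Alpha ((l - 1) div 2) ((l' + 1) div 2) ((l'' - 1) div 2) ((l_cap - 1) div 2)
      * compositions ((l - 1) div 2) n * compositions ((l' + 1) div 2) (j' - j)
      * compositions ((l'' - 1) div 2) (j'' - j) * compositions ((l_cap - 1) div 2) j \<and>
    card {(A, B) \<in> family t j' j'' j l' l'' l_cap l. {1, t} \<inter> A = {1, t} \<and> {1, t} \<inter> B = {t}} =
      smirnov Alpha Gamma ((l - 1) div 2) ((l' + 1) div 2) ((l'' - 1) div 2) ((l_cap + 1) div 2)
      * compositions ((l - 1) div 2) n * compositions ((l' + 1) div 2) (j' - j)
      * compositions ((l'' - 1) div 2) (j'' - j) * compositions ((l_cap + 1) div 2) j \<and>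
    card {(A, B) \<in> family t j' j'' j l' l'' l_cap l. card ({1, t} \<inter> A) = 0 \<and> card ({1, t} \<inter> B) = 0} =
      smirnov Theta Theta ((l + 1) div 2) ((l' - 1) div 2) ((l'' - 1) div 2) ((l_cap - 1) div 2)
      * compositions ((l + 1) div 2) n * compositions ((l' - 1) div 2) (j' - j)
      * compositions ((l'' - 1) div 2) (j'' - j) * compositions ((l_cap - 1) div 2) j \<and>
    card {(A, B) \<in> family t j' j'' j l' l'' l_cap l. card ({1, t} \<inter> A) = 0 \<and> {1, t} \<inter> B = {t}} =
      smirnov Theta Beta ((l + 1) div 2) ((l' - 1) div 2) ((l'' + 1) div 2) ((l_cap - 1) div 2)
      * compositions ((l + 1) div 2) n * compositions ((l' - 1) div 2) (j' - j)
      * compositions ((l'' + 1) div 2) (j'' - j) * compositions ((l_cap - 1) div 2) j \<and>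
    card {(A, B) \<in> family t j' j'' j l' l'' l_cap l. {1, t} \<inter> A = {t} \<and> {1, t} \<inter> B = {t}} =
      smirnov Theta Gamma ((l + 1) div 2) ((l' - 1) div 2) ((l'' - 1) div 2) ((l_cap + 1) div 2)
      * compositions ((l + 1) div 2) n * compositions ((l' - 1) div 2) (j' - j)
      * compositions ((l'' - 1) div 2) (j'' - j) * compositions ((l_cap + 1) div 2) j"
proof -
  have "1 \<noteq> t" using assms(1) by simp
  then have ends: "{1, t} \<inter> S = {1} \<longleftrightarrow> 1 \<in> S \<and> t \<notin> S" "{1, t} \<inter> S = {t} \<longleftrightarrow> 1 \<notin> S \<and> t \<in> S"
    "{1, t} \<inter> S = {1, t} \<longleftrightarrow> 1 \<in> S \<and> t \<in> S" "card ({1, t} \<inter> S) = 0 \<longleftrightarrow> 1 \<notin> S \<and> t \<notin> S" for S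
    by (cases "1 \<in> S"; cases "t \<in> S"; simp add: Int_insert_left doubleton_eq_iff)+
  have "t \<ge> 1" using assms(1) by simp
  note count = card_family_with_ends[OF this assms(4-6) assms(11-15)]
  show ?thesis
    unfolding ends
  proof (intro conjI, goal_cases)
    case 1
    show ?case
      by (subst count[where a = Gamma and b = Theta]) (auto simp: label_eq_iff)
  next
    case 2
    show ?case
      by (subst count[where a = Gamma and b = Beta]) (auto simp: label_eq_iff)
  next
    case 3
    show ?case
      by (subst count[where a = Alpha and b = Theta]) (auto simp: label_eq_iff)
  next
    case 4
    show ?case
      by (subst count[where a = Alpha and b = Beta]) (auto simp: label_eq_iff)
  next
    case 5
    show ?case
      by (subst count[where a = Gamma and b = Gamma]) (auto simp: label_eq_iff)
  next
    case 6
    show ?case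
      by (subst count[where a = Alpha and b = Alpha]) (auto simp: label_eq_iff)
  next
    case 7
    show ?case
      by (subst count[where a = Alpha and b = Gamma]) (auto simp: label_eq_iff)
  next
    case 8
    show ?case
      by (subst count[where a = Theta and b = Theta]) (auto simp: label_eq_iff)
  next
    case 9
    show ?case
      by (subst count[where a = Theta and b = Beta]) (auto simp: label_eq_iff)
  next
    case 10
    show ?case
      by (subst count[where a = Theta and b = Gamma]) (auto simp: label_eq_iff)
  qed
qed

end
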